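(* Let $M$ be a matroid on a finite ground set $E$, and let $N$ be a matroid whose ground set is the set of circuits of $M$. Assume that whenever $C_1, C_2$ are circuits of $M$ with $|C_1 \cup C_2| - r_M(C_1 \cup C_2) = 2$, every circuit $C$ of $M$ with $C \subseteq C_1 \cup C_2$ satisfies $C \in \operatorname{cl}_N(\{C_1, C_2\})$. Then the function $r \colon 2^E \to \mathbb{Z}$ defined for all $X \subseteq E$ by $$r(X) = r_M(X) + r_N(\{C : C \text{ is a circuit of } M|X\})$$ is the rank function of a rank-$r(N)$ lift of $M$.
   Context: $r_M$ denotes the rank function of $M$, $\operatorname{cl}_N$ the closure operator of $N$, and $r(N)$ the rank of $N$. The circuits of $M|X$ are the circuits of $M$ contained in $X$. Given matroids $M$ and $L$ on a common ground set $E$, $L$ is a lift of $M$ if there is a matroid $K$ on a ground set $E \cup F$ (with $F$ disjoint from $E$) such that $M = K/F$ and $L = K \setminus F$; $L$ is a rank-$k$ lift of $M$ if moreover the rank of $L$ exceeds the rank of $M$ by $k$. *)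

theory Defs
  imports Main
begin

record 'a indep_system =
  ground :: "'a set"
  indeps :: "'a set set"

locale matroid =
  fixes M :: "'a indep_system"
  assumes finite_ground: "finite (ground M)"
    and indep_subset: "I \<in> indeps M \<Longrightarrow> I \<subseteq> ground M"
    and indep_empty: "{} \<in> indeps M"
    and indep_down: "I \<in> indeps M \<Longrightarrow> J \<subseteq> I \<Longrightarrow> J \<in> indeps M"
    and indep_augment: "I \<in> indeps M \<Longrightarrow> J \<in> indeps M \<Longrightarrow> card I < card J
      \<Longrightarrow> \<exists>e \<in> J - I. insert e I \<in> indeps M"

definition rank :: "'a indep_system \<Rightarrow> 'a set \<Rightarrow> nat" where
  "rank M X = Max (card ` {I \<in> indeps M. I \<subseteq> X})"

definition total_rank :: "'a indep_system \<Rightarrow> nat" where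
  "total_rank M = rank M (ground M)"

definition cl :: "'a indep_system \<Rightarrow> 'a set \<Rightarrow> 'a set" where
  "cl M X = {e \<in> ground M. rank M (insert e X) = rank M X}"

definition circuits :: "'a indep_system \<Rightarrow> 'a set set" where
  "circuits M = {C. C \<subseteq> ground M \<and> C \<notin> indeps M \<and> (\<forall>D. D \<subset> C \<longrightarrow> D \<in> indeps M)}"

definition restriction :: "'a indep_system \<Rightarrow> 'a set \<Rightarrow> 'a indep_system" where
  "restriction M X = \<lparr>ground = ground M \<inter> X, indeps = {I \<in> indeps M. I \<subseteq> X}\<rparr>"

definition deletion :: "'a indep_system \<Rightarrow> 'a set \<Rightarrow> 'a indep_system" where
  "deletion M T = restriction M (ground M - T)"

text \<open>The contraction \<open>M / T\<close> is the matroid on \<open>E - T\<close> with rank function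
  \<open>X \<mapsto> r(X \<union> T) - r(T)\<close>; its independent sets are the \<open>X\<close> whose rank there is \<open>card X\<close>
  (see \<open>rank_contraction\<close> below).\<close>

definition contraction :: "'a indep_system \<Rightarrow> 'a set \<Rightarrow> 'a indep_system" where
  "contraction M T = \<lparr>ground = ground M - T,
     indeps = {X. X \<subseteq> ground M - T \<and> rank M (X \<union> T) = card X + rank M T}\<rparr>"

definition relabel :: "('a \<Rightarrow> 'b) \<Rightarrow> 'a indep_system \<Rightarrow> 'b indep_system" where
  "relabel f M = \<lparr>ground = f ` ground M, indeps = (\<lambda>I. f ` I) ` indeps M\<rparr>"

text \<open>The ground set \<open>E\<close> may exhaust the type \<open>'a\<close>, which would leave no room for the
  disjoint set \<open>F\<close>. So \<open>K\<close> lives on \<open>'a + nat\<close>, with \<open>E\<close> identified with its copy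
  under \<open>Inl\<close>; as matroids are finite, every \<open>K\<close> on a set \<open>E \<union> F\<close> has such a copy.\<close>

definition is_lift :: "'a indep_system \<Rightarrow> 'a indep_system \<Rightarrow> bool" where
  "is_lift L M \<longleftrightarrow> matroid M \<and> matroid L \<and> ground L = ground M \<and>
     (\<exists>(K :: ('a + nat) indep_system) F.
        matroid K \<and> F \<inter> Inl ` ground M = {} \<and> ground K = Inl ` ground M \<union> F \<and>
        relabel Inl M = contraction K F \<and> relabel Inl L = deletion K F)"

definition is_rank_lift :: "nat \<Rightarrow> 'a indep_system \<Rightarrow> 'a indep_system \<Rightarrow> bool" where
  "is_rank_lift k L M \<longleftrightarrow> is_lift L M \<and> total_rank L = total_rank M + k"

context matroid
begin

lemma finite_indeps: "finite {I \<in> indeps M. I \<subseteq> X}"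
  by (rule finite_subset[of _ "Pow (ground M)"]) (auto dest: indep_subset simp: finite_ground)

lemma card_le_rank: "I \<in> indeps M \<Longrightarrow> I \<subseteq> X \<Longrightarrow> card I \<le> rank M X"
  unfolding rank_def using finite_indeps by (intro Max_ge) auto

lemma rank_attained: "\<exists>I \<in> indeps M. I \<subseteq> X \<and> card I = rank M X"
proof -
  have "rank M X \<in> card ` {I \<in> indeps M. I \<subseteq> X}"
    unfolding rank_def using finite_indeps indep_empty by (intro Max_in) auto
  then show ?thesis by auto
qed

lemma rank_mono: "X \<subseteq> Y \<Longrightarrow> rank M X \<le> rank M Y"
proof -
  assume "X \<subseteq> Y"
  obtain I where I: "I \<in> indeps M" "I \<subseteq> X" "card I = rank M X" using rank_attained by blast
  show ?thesis using card_le_rank[OF I(1), of Y] I \<open>X \<subseteq> Y\<close> by auto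
qed

lemma extend_to_basis:
  assumes "I \<in> indeps M" "I \<subseteq> X"
  shows "\<exists>B \<in> indeps M. I \<subseteq> B \<and> B \<subseteq> X \<and> card B = rank M X"
  using assms
proof (induction "rank M X - card I" arbitrary: I rule: less_induct)
  case less
  show ?case
  proof (cases "card I = rank M X")
    case False
    then have lt: "card I < rank M X" using card_le_rank[OF less.prems] by simp
    obtain J where J: "J \<in> indeps M" "J \<subseteq> X" "card J = rank M X"
      using rank_attained by blast
    obtain e where e: "e \<in> J - I" "insert e I \<in> indeps M"
      using indep_augment[OF less.prems(1) J(1)] J(3) lt by auto
    have "finite I" by (rule finite_subset[OF indep_subset[OF less.prems(1)] finite_ground])
    then have "rank M X - card (insert e I) < rank M X - card I" using e lt by auto
    moreover have "insert e I \<subseteq> X" using e J less.prems by auto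
    ultimately obtain B where "B \<in> indeps M" "insert e I \<subseteq> B" "B \<subseteq> X" "card B = rank M X"
      using less.hyps[of "insert e I"] e(2) by blast
    then show ?thesis by blast
  qed (use less.prems in auto)
qed

lemma rank_contraction:
  assumes X: "X \<subseteq> ground M - T"
  shows "rank (contraction M T) X = rank M (X \<union> T) - rank M T"
proof -
  let ?S = "{I \<in> indeps (contraction M T). I \<subseteq> X}"
  have finX: "finite X" using X finite_ground by (meson finite_Diff finite_subset)
  have fin: "finite (card ` ?S)"
    using finX by (intro finite_imageI finite_subset[of ?S "Pow X"]) auto
  have le: "card I \<le> rank M (X \<union> T) - rank M T" if "I \<in> ?S" for I
  proof -
    have "rank M (I \<union> T) \<le> rank M (X \<union> T)" using that by (intro rank_mono) auto
    then show ?thesis using that by (simp add: contraction_def)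
  qed
  obtain B where B: "B \<in> indeps M" "B \<subseteq> T" "card B = rank M T"
    using rank_attained by blast
  obtain B' where B': "B' \<in> indeps M" "B \<subseteq> B'" "B' \<subseteq> X \<union> T" "card B' = rank M (X \<union> T)"
    using extend_to_basis[OF B(1), of "X \<union> T"] B by blast
  have finB': "finite B'" by (rule finite_subset[OF indep_subset[OF B'(1)] finite_ground])
  have "card (B' \<inter> T) \<le> rank M T"
    by (rule card_le_rank[OF indep_down[OF B'(1)]]) auto
  moreover have "card B \<le> card (B' \<inter> T)" using B B' finB' by (intro card_mono) auto
  ultimately have BT: "card (B' \<inter> T) = rank M T" using B by simp
  let ?I = "B' - T"
  have cI: "card B' = card ?I + rank M T"
    using BT card_Int_Diff[OF finB', of T] by simp
  have "rank M (?I \<union> T) = card B'"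
  proof (rule antisym)
    have "?I \<union> T \<subseteq> X \<union> T" using B' by auto
    then show "rank M (?I \<union> T) \<le> card B'" using rank_mono B'(4) by simp
    show "card B' \<le> rank M (?I \<union> T)" using B' by (intro card_le_rank) auto
  qed
  then have "?I \<in> ?S" using cI B' X by (auto simp: contraction_def)
  moreover have "card ?I = rank M (X \<union> T) - rank M T" using cI B' by simp
  ultimately show ?thesis
    unfolding rank_def[of "contraction M T"] using fin le
    by (intro Max_eqI) (auto intro: rev_image_eqI)
qed

end

end

theory Submission
  imports Defs
begin

text \<open>Everything rests on one exchange property: if \<open>C\<close> and \<open>C\<^sub>0\<close> are circuits of \<open>M\<close> through \<open>e\<close>
  inside \<open>X \<union> {e}\<close>, then \<open>C\<close> is spanned in \<open>N\<close> by \<open>C\<^sub>0\<close> and the circuits inside \<open>X\<close>. One moves from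
  \<open>C\<close> towards \<open>C\<^sub>0\<close>, decreasing \<open>C - C\<^sub>0\<close>: inside \<open>C \<union> C\<^sub>0\<close> there are a circuit \<open>C\<^sub>2\<close>
  avoiding \<open>e\<close> and a circuit \<open>C\<^sub>3\<close> through \<open>e\<close>, closer to \<open>C\<^sub>0\<close>, with \<open>C \<subseteq> C\<^sub>2 \<union> C\<^sub>3\<close> and
  \<open>C\<^sub>2 \<union> C\<^sub>3\<close> of nullity 2, so the hypothesis on \<open>N\<close> applies. The exchange property makes \<open>r\<close> a rank
  function of a matroid \<open>L\<close>. Since \<open>r - r\<^sub>M\<close> is monotone, \<open>M\<close> is a quotient of \<open>L\<close>, and the
  function \<open>X \<union> A \<mapsto> min (r X + |A|) (r\<^sub>M X + k)\<close> on \<open>E \<union> F\<close> with \<open>|F| = k\<close> exhibits \<open>L\<close> as a lift.\<close>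

section \<open>Rank and closure\<close>

context matroid
begin

lemma finite_indep: "I \<in> indeps M \<Longrightarrow> finite I"
  using indep_subset finite_ground finite_subset by blast

lemma rank_insert_ge: "rank M X \<le> rank M (insert e X)"
  by (rule rank_mono) blast

text \<open>If \<open>e\<close> raised the rank of \<open>Y\<close>, extending a basis
  \<open>B\<close> of \<open>X\<close> to a basis of \<open>insert e Y\<close> would have to use
  \<open>e\<close>, and \<open>insert e B\<close> would be an independent set too large for
  \<open>insert e X\<close>.\<close>

lemma rank_insert_eq_mono:
  assumes "rank M (insert e X) = rank M X" "X \<subseteq> Y"
  shows "rank M (insert e Y) = rank M Y"
proof (rule ccontr)
  assume ne: "rank M (insert e Y) \<noteq> rank M Y"
  have lt: "rank M Y < rank M (insert e Y)"
    using ne rank_insert_ge[of Y e] by auto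
  obtain B where B: "B \<in> indeps M" "B \<subseteq> X" "card B = rank M X" using rank_attained by blast
  obtain B' where B': "B' \<in> indeps M" "B \<subseteq> B'" "B' \<subseteq> insert e Y" "card B' = rank M (insert e Y)"
    using extend_to_basis[OF B(1) subset_trans[OF B(2) subset_insertI2[OF assms(2)]]] by blast
  have "\<not> B' \<subseteq> Y" using card_le_rank[OF B'(1), of Y] B'(4) lt by auto
  then have "e \<in> B'" using B'(3) by blast
  moreover have "e \<notin> B"
  proof
    assume "e \<in> B"
    then have "insert e Y = Y" using B assms(2) by auto
    then show False using ne by simp
  qed
  moreover have "insert e B \<in> indeps M" using indep_down[OF B'(1)] B' \<open>e \<in> B'\<close> by simp
  ultimately show False
    using card_le_rank[of "insert e B" "insert e X"] B finite_indep[OF B(1)] assms(1) by auto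
qed

lemma rank_Un_absorb:
  assumes "\<And>y. y \<in> Y \<Longrightarrow> rank M (insert y X) = rank M X"
  shows "rank M (X \<union> Y) = rank M X"
proof (rule ccontr)
  assume "rank M (X \<union> Y) \<noteq> rank M X"
  then have lt: "rank M X < rank M (X \<union> Y)" using rank_mono[of X "X \<union> Y"] by auto
  obtain B where B: "B \<in> indeps M" "B \<subseteq> X" "card B = rank M X" using rank_attained by blast
  obtain B' where B': "B' \<in> indeps M" "B \<subseteq> B'" "B' \<subseteq> X \<union> Y" "card B' = rank M (X \<union> Y)"
    using extend_to_basis[OF B(1), of "X \<union> Y"] B by blast
  obtain x where x: "x \<in> B'" "x \<notin> B" using B B' lt by (metis less_irrefl subsetI subset_antisym)
  have "insert x B \<in> indeps M" using indep_down[OF B'(1)] B' x by simp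
  then have "rank M X < rank M (insert x X)"
    using card_le_rank[of "insert x B" "insert x X"] insert_mono[OF B(2)] B(3)
      finite_indep[OF B(1)] x by auto
  then show False using assms[of x] x B' by (cases "x \<in> X") (auto simp: insert_absorb)
qed

lemma rank_le_card: "finite X \<Longrightarrow> rank M X \<le> card X"
  by (metis rank_attained card_mono)

lemma indep_iff_rank: "finite X \<Longrightarrow> X \<in> indeps M \<longleftrightarrow> rank M X = card X"
  by (metis card_le_rank card_subset_eq le_antisym order_refl rank_attained rank_le_card)

text \<open>Serves the two equations in the definition of a lift: \<open>Q\<close> is the
  independence condition of the contraction or the deletion, read through the embedding
  \<open>f\<close>.\<close>

lemma image_indeps_eq:
  assumes "\<And>X. X \<subseteq> ground M \<Longrightarrow> Q (f ` X) \<longleftrightarrow> rank M X = card X"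
  shows "(\<lambda>I. f ` I) ` indeps M = {S. S \<subseteq> f ` ground M \<and> Q S}"
proof -
  have "I \<in> indeps M \<longleftrightarrow> I \<subseteq> ground M \<and> Q (f ` I)" for I
    using assms indep_subset indep_iff_rank finite_subset[OF _ finite_ground] by metis
  then show ?thesis by (auto simp: subset_image_iff)
qed

lemma rank_insert_le: "rank M (insert e X) \<le> rank M X + 1"
proof -
  obtain B where B: "B \<in> indeps M" "B \<subseteq> insert e X" "card B = rank M (insert e X)"
    using rank_attained by blast
  have "card (B - {e}) \<le> rank M X"
    using B indep_down[OF B(1), of "B - {e}"] by (intro card_le_rank) auto
  then show ?thesis using B(3) finite_indep[OF B(1)] card_Diff_singleton_if[of B e] by (auto split: if_splits)
qed

lemma subset_cl: "X \<subseteq> ground M \<Longrightarrow> X \<subseteq> cl M X"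
  by (auto simp: cl_def insert_absorb)

lemma cl_mono: "X \<subseteq> Y \<Longrightarrow> cl M X \<subseteq> cl M Y"
  by (auto simp: cl_def dest: rank_insert_eq_mono)

lemma rank_Un_cl: "Y \<subseteq> cl M X \<Longrightarrow> rank M (X \<union> Y) = rank M X"
  by (rule rank_Un_absorb) (auto simp: cl_def)

lemma cl_minimal:
  assumes "Y \<subseteq> cl M X"
  shows "cl M Y \<subseteq> cl M X"
proof
  fix e assume e: "e \<in> cl M Y"
  then have "rank M (insert e (X \<union> Y)) = rank M (X \<union> Y)"
    using cl_mono[of Y "X \<union> Y"] by (auto simp: cl_def)
  then have "rank M (insert e X) \<le> rank M X"
    using rank_Un_cl[OF assms] rank_mono[of "insert e X" "insert e (X \<union> Y)"] by auto
  then show "e \<in> cl M X" using e rank_insert_ge[of X e] by (auto simp: cl_def)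
qed

lemma rank_eq_imp_subset_cl:
  assumes "X \<subseteq> Y" "Y \<subseteq> ground M" "rank M Y = rank M X"
  shows "Y \<subseteq> cl M X"
proof
  fix y assume "y \<in> Y"
  then have "rank M (insert y X) \<le> rank M X"
    using assms rank_mono[of "insert y X" Y] by auto
  then show "y \<in> cl M X"
    using \<open>y \<in> Y\<close> assms rank_insert_ge[of X y] by (auto simp: cl_def)
qed

section \<open>Circuits and nullity\<close>

lemma circuit_subset_ground: "C \<in> circuits M \<Longrightarrow> C \<subseteq> ground M"
  by (simp add: circuits_def)

lemma finite_circuit: "C \<in> circuits M \<Longrightarrow> finite C"
  using circuit_subset_ground finite_ground finite_subset by blast

lemma circuit_not_empty: "{} \<notin> circuits M"
  by (simp add: circuits_def indep_empty)

lemma circuit_subset_eq: "C \<in> circuits M \<Longrightarrow> D \<in> circuits M \<Longrightarrow> C \<subseteq> D \<Longrightarrow> C = D"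
  by (auto simp: circuits_def)

lemma circuits_restriction: "circuits (restriction M X) = {C \<in> circuits M. C \<subseteq> X}"
  unfolding circuits_def restriction_def by (auto 4 3)

lemma dependent_contains_circuit:
  assumes "X \<subseteq> ground M" "X \<notin> indeps M"
  shows "\<exists>C \<in> circuits M. C \<subseteq> X"
proof -
  have "finite X" using assms finite_ground finite_subset by blast
  then show ?thesis using assms
  proof (induction rule: finite_psubset_induct)
    case (psubset X)
    show ?case
    proof (cases "X \<in> circuits M")
      case False
      then obtain D where "D \<subset> X" "D \<notin> indeps M" using psubset.prems by (auto simp: circuits_def)
      then show ?thesis using psubset.IH[of D] psubset.prems by blast
    qed auto
  qed
qed

lemma rank_circuit_remove:
  assumes "C \<in> circuits M" "e \<in> C"
  shows "rank M (C - {e}) = rank M C"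
proof (rule antisym)
  have "C - {e} \<in> indeps M" "C \<notin> indeps M" using assms by (auto simp: circuits_def)
  moreover have "finite C" using assms finite_circuit by blast
  ultimately have "rank M (C - {e}) = card C - 1" "rank M C \<noteq> card C" "rank M C \<le> card C"
    using assms indep_iff_rank rank_le_card by auto
  then show "rank M C \<le> rank M (C - {e})" by linarith
qed (rule rank_mono, blast)

lemma rank_insert_circuit:
  assumes "C \<in> circuits M" "e \<in> C" "C \<subseteq> insert e X"
  shows "rank M (insert e X) = rank M X"
proof (rule rank_insert_eq_mono)
  show "rank M (insert e (C - {e})) = rank M (C - {e})"
    using rank_circuit_remove[OF assms(1,2)] assms(2) by (simp add: insert_absorb)
qed (use assms in auto)

text \<open>A basis \<open>B\<close> of \<open>X\<close> together with \<open>e\<close> exceeds the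
  rank of \<open>insert e X\<close>, hence is dependent; a circuit in it uses \<open>e\<close>
  because \<open>B\<close> is independent.\<close>

lemma obtain_circuit:
  assumes "rank M (insert e X) = rank M X" "e \<in> ground M" "e \<notin> X"
  obtains C where "C \<in> circuits M" "e \<in> C" "C \<subseteq> insert e X"
proof -
  obtain B where B: "B \<in> indeps M" "B \<subseteq> X" "card B = rank M X" using rank_attained by blast
  have "e \<notin> B" using B(2) assms(3) by blast
  then have "insert e B \<notin> indeps M"
    using card_le_rank[of "insert e B" "insert e X"] insert_mono[OF B(2)] B(3) finite_indep[OF B(1)] assms(1)
    by auto
  then obtain C where C: "C \<in> circuits M" "C \<subseteq> insert e B"
    using dependent_contains_circuit[of "insert e B"] indep_subset[OF B(1)] assms(2) by blast
  have "e \<in> C"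
    using C indep_down[OF B(1), of C] by (auto simp: circuits_def)
  then show thesis using that C B by blast
qed

text \<open>Let \<open>W\<close> be the union without \<open>g\<close> and \<open>e\<close>. Then
  \<open>C2\<close>, which avoids \<open>e\<close>, puts \<open>g\<close> in the span of
  \<open>W\<close>, and \<open>C1\<close> puts \<open>e\<close> in the span of
  \<open>insert g W\<close>. So \<open>W\<close> spans \<open>e\<close>, and the resulting circuit
  avoids \<open>g\<close>.\<close>

lemma strong_circuit_elimination:
  assumes "C1 \<in> circuits M" "C2 \<in> circuits M" "g \<in> C1 \<inter> C2" "e \<in> C1 - C2"
  obtains C where "C \<in> circuits M" "e \<in> C" "C \<subseteq> C1 \<union> C2 - {g}"
proof -
  define W where "W = C1 \<union> C2 - {g, e}"
  have 1: "rank M (insert g W) = rank M W"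
    using assms by (intro rank_insert_circuit[of C2]) (auto simp: W_def)
  have 2: "rank M (insert e (insert g W)) = rank M (insert g W)"
    using assms by (intro rank_insert_circuit[of C1]) (auto simp: W_def)
  have "rank M (insert e W) = rank M W"
    using 1 2 rank_mono[OF insert_mono[OF subset_insertI[of W g]], of e] rank_insert_ge[of W e] by auto
  moreover have "e \<in> ground M" "e \<notin> W"
    using assms circuit_subset_ground by (auto simp: W_def)
  ultimately obtain C where "C \<in> circuits M" "e \<in> C" "C \<subseteq> insert e W"
    using obtain_circuit by blast
  then show thesis using that[of C] assms by (auto simp: W_def)
qed

end

text \<open>On finite sets the truncated subtraction loses nothing, since the rank is at most the
  cardinality.\<close>

definition nullity :: "'a indep_system \<Rightarrow> 'a set \<Rightarrow> nat" where
  "nullity M X = card X - rank M X"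

section \<open>Nullity of unions of circuits\<close>

context matroid
begin

lemma card_eq_nullity: "finite X \<Longrightarrow> card X = rank M X + nullity M X"
  using rank_le_card by (simp add: nullity_def)

lemma nullity_insert:
  assumes "finite X"
  shows "nullity M X \<le> nullity M (insert e X)" "nullity M (insert e X) \<le> nullity M X + 1"
proof -
  have "nullity M X \<le> nullity M (insert e X) \<and> nullity M (insert e X) \<le> nullity M X + 1"
  proof (cases "e \<in> X")
    case True
    then show ?thesis by (simp add: insert_absorb)
  next
    case False
    then show ?thesis
      using card_eq_nullity[OF assms] card_eq_nullity[of "insert e X"] rank_insert_le[of e X]
        rank_insert_ge[of X e] assms
      by simp
  qed
  then show "nullity M X \<le> nullity M (insert e X)" "nullity M (insert e X) \<le> nullity M X + 1"
    by auto
qed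

lemma nullity_mono:
  assumes "X \<subseteq> Y" "finite Y"
  shows "nullity M X \<le> nullity M Y"
proof -
  have "nullity M X \<le> nullity M (X \<union> Z)" if "finite Z" for Z
    using that
  proof (induction Z)
    case (insert z Z)
    then show ?case
      using nullity_insert(1)[of "X \<union> Z" z] assms finite_subset[OF assms] by auto
  qed simp
  from this[OF assms(2)] show ?thesis using assms(1) by (simp add: Un_absorb1)
qed

lemma nullity_remove_circuit:
  assumes "C \<in> circuits M" "x \<in> C" "C \<subseteq> Y" "finite Y"
  shows "nullity M Y = nullity M (Y - {x}) + 1"
proof -
  have "rank M Y = rank M (Y - {x})"
    using rank_insert_circuit[of C x "Y - {x}"] assms(1-3) by (simp add: insert_absorb subset_iff)
  moreover have "card Y = card (Y - {x}) + 1"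
    using assms by (metis Suc_eq_plus1 card.remove subsetD)
  ultimately show ?thesis
    using card_eq_nullity[of Y] card_eq_nullity[of "Y - {x}"] assms(4) by simp
qed

lemma nullity_circuit:
  assumes "C \<in> circuits M"
  shows "nullity M C = 1"
proof -
  obtain x where x: "x \<in> C" using assms circuit_not_empty by fastforce
  have "C - {x} \<in> indeps M" using assms x by (auto simp: circuits_def)
  then have "nullity M (C - {x}) = 0" using finite_circuit[OF assms]
    by (simp add: nullity_def indep_iff_rank)
  then show ?thesis
    using nullity_remove_circuit[OF assms x subset_refl finite_circuit[OF assms]] by simp
qed

text \<open>Deleting a point of \<open>C\<close> outside \<open>D\<close> lowers the nullity by one
  and still leaves all of \<open>D\<close>, which has nullity 1.\<close>

lemma nullity_union_circuits:
  assumes "C \<in> circuits M" "D \<in> circuits M" "C \<noteq> D"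
  shows "2 \<le> nullity M (C \<union> D)"
proof -
  obtain x where x: "x \<in> C" "x \<notin> D" using assms circuit_subset_eq by blast
  have fin: "finite (C \<union> D)" using assms finite_circuit by blast
  have "nullity M D \<le> nullity M (C \<union> D - {x})" using x fin by (intro nullity_mono) auto
  then show ?thesis
    using nullity_circuit[OF assms(2)] nullity_remove_circuit[OF assms(1) x(1) _ fin] by simp
qed

text \<open>Points of \<open>Y\<close> outside \<open>C\<close> are removed one at a time; each
  removal lowers the nullity by at most one, so the value 2 is not skipped.\<close>

lemma obtain_nullity_2:
  assumes "C \<subseteq> Y" "finite Y" "nullity M C < 2" "2 \<le> nullity M Y"
  obtains Z where "C \<subseteq> Z" "Z \<subseteq> Y" "nullity M Z = 2"
proof -
  have "\<exists>Z. C \<subseteq> Z \<and> Z \<subseteq> Y \<and> nullity M Z = 2"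
    using assms(2,1,4)
  proof (induction rule: finite_psubset_induct)
    case (psubset Y)
    obtain y where y: "y \<in> Y" "y \<notin> C" using psubset.prems assms(3) by (metis leD subsetI subset_antisym)
    have "nullity M Y \<le> nullity M (Y - {y}) + 1"
      using nullity_insert(2)[of "Y - {y}" y] psubset.hyps y by (simp add: insert_absorb)
    then consider "nullity M Y = 2" | "2 \<le> nullity M (Y - {y})" using psubset.prems by linarith
    then show ?case
    proof cases
      case 2
      then show ?thesis using psubset.IH[of "Y - {y}"] y psubset.prems by blast
    qed (use psubset.prems in blast)
  qed
  then show thesis using that by blast
qed

text \<open>A step from \<open>C\<close> towards \<open>C0\<close> within the circuits through \<open>e\<close>. The circuit \<open>C2\<close> cannot lie in
  \<open>C0\<close>, which supplies the element eliminated to obtain \<open>C3\<close>.\<close>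

lemma circuit_step:
  assumes C: "C \<in> circuits M" and C0: "C0 \<in> circuits M" and ne: "C \<noteq> C0"
    and e: "e \<in> C" "e \<in> C0"
  obtains C2 C3 where "C2 \<in> circuits M" "e \<notin> C2" "C2 \<subseteq> C \<union> C0"
    "C3 \<in> circuits M" "e \<in> C3" "C3 \<subseteq> C \<union> C0" "C3 - C0 \<subset> C - C0"
    "C \<subseteq> C2 \<union> C3" "nullity M (C2 \<union> C3) = 2"
proof -
  have fin: "finite (C \<union> C0)" using C C0 finite_circuit by blast
  obtain Z where Z: "C \<subseteq> Z" "Z \<subseteq> C \<union> C0" "nullity M Z = 2"
    using obtain_nullity_2[of C "C \<union> C0"] fin nullity_circuit[OF C]
      nullity_union_circuits[OF C C0 ne] by auto
  have finZ: "finite Z" using Z fin finite_subset by blast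
  have "nullity M (Z - {e}) = 1" using nullity_remove_circuit[OF C e(1) Z(1) finZ] Z by simp
  then have "Z - {e} \<notin> indeps M" using indep_iff_rank[of "Z - {e}"] finZ by (auto simp: nullity_def)
  moreover have "Z - {e} \<subseteq> ground M" using Z C C0 circuit_subset_ground by blast
  ultimately obtain C2 where C2: "C2 \<in> circuits M" "C2 \<subseteq> Z - {e}"
    using dependent_contains_circuit by blast
  have "\<not> C2 \<subseteq> C0" using circuit_subset_eq[OF C2(1) C0] C2 e by auto
  then obtain g where g: "g \<in> C2" "g \<notin> C0" by blast
  then have gC: "g \<in> C" using C2 Z by blast
  obtain C3 where C3: "C3 \<in> circuits M" "e \<in> C3" "C3 \<subseteq> C \<union> C2 - {g}"
    using strong_circuit_elimination[OF C C2(1), of g e] g gC e C2 by blast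
  have sub: "C2 \<union> C3 \<subseteq> Z" using C2 C3 Z by blast
  have ge: "2 \<le> nullity M (C2 \<union> C3)"
    using nullity_union_circuits[OF C2(1) C3(1)] C2 C3 by blast
  have null: "nullity M (C2 \<union> C3) = 2" using ge nullity_mono[OF sub finZ] Z by simp
  \<comment> \<open>A point \<open>x\<close> of \<open>C\<close> missed by both circuits would put
    their union inside \<open>Z - {x}\<close>, whose nullity is only 1.\<close>
  have "C \<subseteq> C2 \<union> C3"
  proof
    fix x assume x: "x \<in> C"
    show "x \<in> C2 \<union> C3"
    proof (rule ccontr)
      assume "x \<notin> C2 \<union> C3"
      then have "nullity M (C2 \<union> C3) \<le> nullity M (Z - {x})"
        using sub finZ by (intro nullity_mono) auto
      then show False using nullity_remove_circuit[OF C x Z(1) finZ] Z ge by simp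
    qed
  qed
  moreover have "C3 - C0 \<subset> C - C0" using C3 C2 Z g gC by blast
  moreover have "e \<notin> C2" "C2 \<subseteq> C \<union> C0" "C3 \<subseteq> C \<union> C0" using C2(2) sub Z(2) by auto
  ultimately show thesis using that[OF C2(1) _ _ C3(1,2)] null by simp
qed

end

section \<open>Matroids from rank functions\<close>

text \<open>The local form of the rank axioms: unit increase, and submodularity only where two
  single elements each leave the value unchanged. Only one-element extensions then need
  checking.\<close>

locale rank_function =
  fixes E :: "'a set" and \<rho> :: "'a set \<Rightarrow> nat"
  assumes finite_E: "finite E"
    and rho_empty: "\<rho> {} = 0"
    and rho_insert_ge: "X \<subseteq> E \<Longrightarrow> e \<in> E \<Longrightarrow> \<rho> X \<le> \<rho> (insert e X)"
    and rho_insert_le: "X \<subseteq> E \<Longrightarrow> e \<in> E \<Longrightarrow> \<rho> (insert e X) \<le> \<rho> X + 1"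
    and rho_local: "X \<subseteq> E \<Longrightarrow> a \<in> E \<Longrightarrow> b \<in> E \<Longrightarrow> \<rho> (insert a X) = \<rho> X
      \<Longrightarrow> \<rho> (insert b X) = \<rho> X \<Longrightarrow> \<rho> (insert a (insert b X)) = \<rho> X"
begin

definition rank_matroid :: "'a indep_system" where
  "rank_matroid = \<lparr>ground = E, indeps = {I. I \<subseteq> E \<and> \<rho> I = card I}\<rparr>"

lemma rho_Un:
  assumes "X \<subseteq> E" "Y \<subseteq> E"
  shows "\<rho> X \<le> \<rho> (X \<union> Y)" "\<rho> (X \<union> Y) \<le> \<rho> X + card Y"
proof -
  have "finite Y" using assms finite_E finite_subset by blast
  then have "\<rho> X \<le> \<rho> (X \<union> Y) \<and> \<rho> (X \<union> Y) \<le> \<rho> X + card Y" using assms(2)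
  proof (induction Y)
    case (insert y Y)
    then show ?case
      using rho_insert_ge[of "X \<union> Y" y] rho_insert_le[of "X \<union> Y" y] assms(1) by auto
  qed simp
  then show "\<rho> X \<le> \<rho> (X \<union> Y)" "\<rho> (X \<union> Y) \<le> \<rho> X + card Y" by auto
qed

text \<open>Elements of \<open>Y\<close> are added one by one; by \<open>rho_local\<close>, adding
  \<open>y\<close> keeps every remaining element from raising the value.\<close>

lemma rho_absorb:
  assumes "X \<subseteq> E" "Y \<subseteq> E" "\<And>y. y \<in> Y \<Longrightarrow> \<rho> (insert y X) = \<rho> X"
  shows "\<rho> (X \<union> Y) = \<rho> X"
proof -
  have "finite Y" using assms finite_E finite_subset by blast
  then show ?thesis using assms
  proof (induction Y arbitrary: X)
    case (insert y Y)
    have "\<rho> (insert z (insert y X)) = \<rho> (insert y X)" if "z \<in> Y" for z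
      using rho_local[of X z y] insert.prems that by auto
    then have "\<rho> (insert y X \<union> Y) = \<rho> (insert y X)"
      using insert.prems by (intro insert.IH) auto
    then show ?case using insert.prems by simp
  qed simp
qed

lemma matroid_rank_matroid: "matroid rank_matroid"
proof
  show "finite (ground rank_matroid)" by (simp add: rank_matroid_def finite_E)
  show "{} \<in> indeps rank_matroid" by (simp add: rank_matroid_def rho_empty)
  show "I \<subseteq> ground rank_matroid" if "I \<in> indeps rank_matroid" for I
    using that by (simp add: rank_matroid_def)
  show "J \<in> indeps rank_matroid" if "I \<in> indeps rank_matroid" "J \<subseteq> I" for I J
  proof -
    have I: "I \<subseteq> E" "\<rho> I = card I" using that by (auto simp: rank_matroid_def)
    have fin: "finite I" using I finite_E finite_subset by blast
    have J: "J \<subseteq> E" using I that by auto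
    have "J \<union> (I - J) = I" using that by auto
    then have "card I \<le> \<rho> J + card (I - J)" using rho_Un(2)[of J "I - J"] I J by auto
    moreover have "card I = card J + card (I - J)"
      using that fin by (metis card_Diff_subset card_mono finite_subset le_add_diff_inverse)
    moreover have "\<rho> J \<le> card J" using rho_Un(2)[of "{}" J] rho_empty J by simp
    ultimately show ?thesis using J by (simp add: rank_matroid_def)
  qed
  show "\<exists>e\<in>J - I. insert e I \<in> indeps rank_matroid"
    if "I \<in> indeps rank_matroid" "J \<in> indeps rank_matroid" "card I < card J" for I J
  proof (rule ccontr)
    assume no: "\<not> ?thesis"
    have I: "I \<subseteq> E" "\<rho> I = card I" and J: "J \<subseteq> E" "\<rho> J = card J"
      using that by (auto simp: rank_matroid_def)
    have fin: "finite I" using I finite_E finite_subset by blast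
    \<comment> \<open>Without an augmenting element, \<open>I\<close> absorbs all of
      \<open>J\<close>, so the value on \<open>I \<union> J\<close> would be \<open>card I\<close>,
      below the value \<open>card J\<close> on \<open>J\<close>.\<close>
    have "\<rho> (insert y I) = \<rho> I" if y: "y \<in> J" for y
    proof (cases "y \<in> I")
      case False
      then have "\<rho> (insert y I) \<noteq> card I + 1"
        using no y I J fin by (auto simp: rank_matroid_def)
      then show ?thesis
        using rho_insert_ge[of I y] rho_insert_le[of I y] I J y by fastforce
    qed (simp add: insert_absorb)
    then have "\<rho> (I \<union> J) = \<rho> I" using rho_absorb I J by blast
    then show False using rho_Un(1)[of J I] I J that(3) by (simp add: Un_commute)
  qed
qed

text \<open>A largest independent subset \<open>I\<close> of \<open>X\<close> cannot be augmented
  inside \<open>X\<close>, so it absorbs \<open>X\<close>, and both sides equal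
  \<open>card I\<close>.\<close>

lemma rank_rank_matroid:
  assumes "X \<subseteq> E"
  shows "rank rank_matroid X = \<rho> X"
proof -
  interpret R: matroid rank_matroid by (rule matroid_rank_matroid)
  obtain I where I: "I \<in> indeps rank_matroid" "I \<subseteq> X" "card I = rank rank_matroid X"
    using R.rank_attained by blast
  have I': "I \<subseteq> E" "\<rho> I = card I" using I by (auto simp: rank_matroid_def)
  have "\<rho> (insert x I) = \<rho> I" if x: "x \<in> X" for x
  proof (cases "x \<in> I")
    case False
    have "\<rho> (insert x I) \<noteq> card I + 1"
    proof
      assume "\<rho> (insert x I) = card I + 1"
      then have "insert x I \<in> indeps rank_matroid"
        using False I' x assms R.finite_indep[OF I(1)] by (auto simp: rank_matroid_def)
      from R.card_le_rank[OF this, of X] show False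
        using False I x R.finite_indep[OF I(1)] by simp
    qed
    then show ?thesis
      using rho_insert_ge[of I x] rho_insert_le[of I x] I' x assms by fastforce
  qed (simp add: insert_absorb)
  then have "\<rho> (I \<union> X) = \<rho> I" using rho_absorb[OF I'(1) assms] by blast
  then show ?thesis using I I' by (simp add: Un_absorb1)
qed

lemma ground_rank_matroid: "ground rank_matroid = E"
  by (simp add: rank_matroid_def)

end

section \<open>Quotients and lifts\<close>

lemma quotient_is_lift:
  fixes M L :: "'a indep_system"
  assumes M: "matroid M" and L: "matroid L" and gr: "ground L = ground M"
    and quot: "\<And>X Y. X \<subseteq> Y \<Longrightarrow> Y \<subseteq> ground M \<Longrightarrow> rank M Y + rank L X \<le> rank L Y + rank M X"
  shows "is_lift L M"
proof -
  interpret M: matroid M by fact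
  interpret L: matroid L by fact
  define k where "k = total_rank L - total_rank M"
  define F :: "('a + nat) set" where "F = Inr ` {..<k}"
  \<comment> \<open>This is the rank function of the \<open>k\<close>-th Higgs lift of
    \<open>M\<close> with loops \<open>F\<close> towards \<open>L\<close> with coloops
    \<open>F\<close>.\<close>
  define \<rho> :: "('a + nat) set \<Rightarrow> nat" where
    "\<rho> S = min (rank L (Inl -` S) + card (S \<inter> F)) (rank M (Inl -` S) + k)" for S
  let ?E = "Inl ` ground M \<union> F"
  have finF: "finite F" "card F = k" by (simp_all add: F_def card_image)
  have vInl: "Inl -` insert (Inl a) S = insert a (Inl -` S)" for a and S :: "('a + nat) set" by auto
  have vInr: "Inl -` insert (Inr b) S = Inl -` S" for b and S :: "('a + nat) set" by auto
  have iInl: "insert (Inl a) S \<inter> F = S \<inter> F" for a S by (auto simp: F_def)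
  have iInr: "card (insert (Inr b) S \<inter> F) = (if Inr b \<in> S then card (S \<inter> F) else card (S \<inter> F) + 1)"
    if "Inr b \<in> F" for b S
    using that finF(1) by (auto simp: insert_absorb Int_insert_left)
  have L0: "rank L {} = 0" and M0: "rank M {} = 0" using L.rank_le_card[of "{}"] M.rank_le_card[of "{}"] by auto
  have rank_le: "rank M X \<le> rank L X" if "X \<subseteq> ground M" for X
    using quot[of "{}" X] that L0 M0 by simp
  \<comment> \<open>The excess of \<open>L\<close> over \<open>M\<close> is monotone, so it is
    bounded by its value \<open>k\<close> on the ground set.\<close>
  have Lk: "rank L X \<le> rank M X + k" if "X \<subseteq> ground M" for X
    using quot[of X "ground M"] that gr rank_le[of "ground M"] unfolding k_def total_rank_def by simp
  have v: "Inl -` S \<subseteq> ground M" if "S \<subseteq> ?E" for S using that by (auto simp: F_def)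
  have step: "rank M X + rank L (insert a X) \<ge> rank M (insert a X) + rank L X"
    if "X \<subseteq> ground M" "a \<in> ground M" for a X
    using quot[OF subset_insertI[of X a]] that by auto
  interpret R: rank_function ?E \<rho>
  proof
    show "finite ?E" using finF M.finite_ground by simp
    show "\<rho> {} = 0" using L0 by (simp add: \<rho>_def)
  next
    fix X e assume X: "X \<subseteq> ?E" and e: "e \<in> ?E"
    have "\<rho> X \<le> \<rho> (insert e X) \<and> \<rho> (insert e X) \<le> \<rho> X + 1"
    proof (cases e)
      case (Inl a)
      then have "a \<in> ground M" using e by (auto simp: F_def)
      then show ?thesis
        unfolding \<rho>_def Inl vInl iInl
        using step[OF v[OF X]] M.rank_insert_le[of a "Inl -` X"] L.rank_insert_le[of a "Inl -` X"]
          M.rank_insert_ge[of "Inl -` X" a] L.rank_insert_ge[of "Inl -` X" a]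
        by force
    next
      case (Inr b)
      then have "Inr b \<in> F" using e by auto
      from iInr[OF this, of X] show ?thesis unfolding \<rho>_def Inr vInr by auto
    qed
    then show "\<rho> X \<le> \<rho> (insert e X)" "\<rho> (insert e X) \<le> \<rho> X + 1" by auto
  next
    fix X a b
    assume X: "X \<subseteq> ?E" and a: "a \<in> ?E" and b: "b \<in> ?E"
      and eq: "\<rho> (insert a X) = \<rho> X" "\<rho> (insert b X) = \<rho> X"
    let ?V = "Inl -` X"
    \<comment> \<open>A new element of \<open>F\<close> always raises the first term of the minimum,
      so an unchanged value means that the second term attains it.\<close>
    have sat: "rank M ?V + k \<le> rank L ?V + card (X \<inter> F)"
      if "Inr c \<in> F" "Inr c \<notin> X" "\<rho> (insert (Inr c) X) = \<rho> X" for c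
      using that iInr[OF that(1), of X] unfolding \<rho>_def vInr by (auto simp: min_def split: if_splits)
    \<comment> \<open>If the rank in \<open>M\<close> rose, so would the rank in \<open>L\<close>,
      by \<open>step\<close>, and both terms would grow. Hence the second term is fixed, and the
      first may grow only when the second attains the minimum.\<close>
    have stay: "rank M (insert c ?V) = rank M ?V
        \<and> (rank L (insert c ?V) = rank L ?V \<or> rank M ?V + k \<le> rank L ?V + card (X \<inter> F))"
      if "\<rho> (insert (Inl c) X) = \<rho> X" "c \<in> ground M" for c
      using that(1) step[OF v[OF X] that(2)]
        M.rank_insert_ge[of ?V c] L.rank_insert_ge[of ?V c]
      unfolding \<rho>_def vInl iInl by (auto simp: min_def split: if_splits)
    have Mabs: "rank M (insert c (insert d ?V)) = rank M ?V"
      if "rank M (insert c ?V) = rank M ?V" "rank M (insert d ?V) = rank M ?V" for c d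
      using M.rank_Un_absorb[of "{c, d}" ?V] that by auto
    have Labs: "rank L (insert c (insert d ?V)) = rank L ?V"
      if "rank L (insert c ?V) = rank L ?V" "rank L (insert d ?V) = rank L ?V" for c d
      using L.rank_Un_absorb[of "{c, d}" ?V] that by auto
    have Lmono: "rank L ?V \<le> rank L (insert c (insert d ?V))" "rank L ?V \<le> rank L (insert c ?V)" for c d
      by (rule L.rank_mono; blast)+
    show "\<rho> (insert a (insert b X)) = \<rho> X"
    proof (cases "a \<in> X \<or> b \<in> X")
      case True
      then show ?thesis using eq by (metis insert_absorb insert_commute)
    next
      case out: False
      show ?thesis
      proof (cases a)
        case a': (Inl c)
        have c: "c \<in> ground M" using a a' by (auto simp: F_def)
        have sc: "rank M (insert c ?V) = rank M ?V
            \<and> (rank L (insert c ?V) = rank L ?V \<or> rank M ?V + k \<le> rank L ?V + card (X \<inter> F))"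
          using stay[of c] eq(1) c a' by simp
        show ?thesis
        proof (cases b)
          case b': (Inl d)
          have d: "d \<in> ground M" using b b' by (auto simp: F_def)
          have "rank M (insert d ?V) = rank M ?V
            \<and> (rank L (insert d ?V) = rank L ?V \<or> rank M ?V + k \<le> rank L ?V + card (X \<inter> F))"
            using stay[of d] eq(2) d b' by simp
          then show ?thesis unfolding \<rho>_def a' b' vInl iInl
            using sc Mabs[of c d] Labs[of c d] Lmono(1)[of c d] by auto
        next
          case b': (Inr d)
          have "Inr d \<in> F" "Inr d \<notin> X" using b b' out by auto
          with sat[of d] eq(2) b' iInr[of d X] show ?thesis
            unfolding \<rho>_def a' b' vInl iInl vInr using sc Lmono(2)[of c] by auto
        qed
      next
        case a': (Inr c)
        have c: "Inr c \<in> F" "Inr c \<notin> X" using a a' out by auto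
        have s: "rank M ?V + k \<le> rank L ?V + card (X \<inter> F)" using sat[of c] c eq(1) a' by simp
        show ?thesis
        proof (cases b)
          case b': (Inl d)
          have d: "d \<in> ground M" using b b' by (auto simp: F_def)
          have "card (insert (Inr c) (insert (Inl d) X) \<inter> F) \<ge> card (X \<inter> F)"
            using finF by (intro card_mono) auto
          then show ?thesis unfolding \<rho>_def a' b' vInl vInr
            using s stay[of d] eq(2) d b' Lmono(2)[of d] by auto
        next
          case b': (Inr d)
          have "card (insert (Inr c) (insert (Inr d) X) \<inter> F) \<ge> card (X \<inter> F)"
            using finF by (intro card_mono) auto
          then show ?thesis unfolding \<rho>_def a' b' vInl vInr using s by auto
        qed
      qed
    qed
  qed
  let ?K = "R.rank_matroid"
  have vI: "Inl -` (Inl ` X) = X" "Inl -` (Inl ` X \<union> F) = X" for X :: "'a set" by (auto simp: F_def)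
  \<comment> \<open>On \<open>X \<union> F\<close> the second term is the smaller by
    \<open>rank_le\<close>; on \<open>X\<close> alone the first is, by \<open>Lk\<close>.\<close>
  have rK: "rank ?K (Inl ` X \<union> F) = rank M X + k" "rank ?K (Inl ` X) = rank L X"
    if "X \<subseteq> ground M" for X
  proof -
    have "Inl ` X \<subseteq> ?E" "Inl ` X \<union> F \<subseteq> ?E" using that by auto
    moreover have "Inl ` X \<inter> F = {}" "(Inl ` X \<union> F) \<inter> F = F" by (auto simp: F_def)
    ultimately show "rank ?K (Inl ` X \<union> F) = rank M X + k" "rank ?K (Inl ` X) = rank L X"
      using R.rank_rank_matroid rank_le[OF that] Lk[OF that] by (simp_all add: \<rho>_def vI finF del: vimage_Un)
  qed
  have rKF: "rank ?K F = k" using rK(1)[of "{}"] M0 by simp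
  have disj: "F \<inter> Inl ` ground M = {}" by (auto simp: F_def)
  have gK: "ground ?K - F = Inl ` ground M" using disj by (auto simp: R.ground_rank_matroid)
  have cardI: "card (Inl ` X :: ('a + nat) set) = card X" for X :: "'a set" by (simp add: card_image)
  have "relabel Inl M = contraction ?K F"
    unfolding relabel_def contraction_def gK
    by (simp, rule M.image_indeps_eq) (simp add: rK(1) rKF cardI)
  moreover have "relabel Inl L = deletion ?K F"
  proof -
    interpret K: matroid ?K by (rule R.matroid_rank_matroid)
    have fin: "finite S" if "S \<subseteq> Inl ` ground M" for S :: "('a + nat) set"
      using that M.finite_ground finite_subset by blast
    have "(\<lambda>I. Inl ` I) ` indeps L = {S. S \<subseteq> Inl ` ground L \<and> rank ?K S = card S}"
      by (rule L.image_indeps_eq) (simp add: rK(2) cardI gr)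
    also have "\<dots> = {I \<in> indeps ?K. I \<subseteq> Inl ` ground M}"
      using K.indep_iff_rank fin gr by auto
    finally show ?thesis using gK by (auto simp: relabel_def deletion_def restriction_def gr)
  qed
  ultimately show ?thesis
    unfolding is_lift_def using M L gr R.matroid_rank_matroid disj R.ground_rank_matroid by blast
qed

section \<open>The lift determined by a matroid on the circuits\<close>

locale circuit_matroid = M: matroid M + N: matroid N
  for M :: "'a indep_system" and N :: "'a set indep_system" +
  assumes ground_N: "ground N = circuits M"
    and modular_cl: "C1 \<in> circuits M \<Longrightarrow> C2 \<in> circuits M \<Longrightarrow> nullity M (C1 \<union> C2) = 2
      \<Longrightarrow> C \<in> circuits M \<Longrightarrow> C \<subseteq> C1 \<union> C2 \<Longrightarrow> C \<in> cl N {C1, C2}"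
begin

abbreviation circs :: "'a set \<Rightarrow> 'a set set" where
  "circs X \<equiv> {C \<in> circuits M. C \<subseteq> X}"

lemma circs_subset: "circs X \<subseteq> ground N"
  by (auto simp: ground_N)

lemma circs_mono: "X \<subseteq> Y \<Longrightarrow> circs X \<subseteq> circs Y"
  by auto

lemma circuit_exchange:
  assumes "C0 \<in> circs (insert e X)" "e \<in> C0" "C \<in> circs (insert e X)" "e \<in> C"
  shows "C \<in> cl N (insert C0 (circs (X - {e})))"
  using assms(3,4)
proof (induction "card (C - C0)" arbitrary: C rule: less_induct)
  case less
  let ?S = "insert C0 (circs (X - {e}))"
  have S: "?S \<subseteq> cl N ?S" using assms(1) by (intro N.subset_cl) (auto simp: ground_N)
  show ?case
  proof (cases "C = C0")
    case True
    then show ?thesis using S by blast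
  next
    case False
    have "C \<in> circuits M" "C0 \<in> circuits M" using less.prems assms by auto
    from M.circuit_step[OF this False less.prems(2) assms(2)]
    obtain C2 C3 where C2: "C2 \<in> circuits M" "e \<notin> C2" "C2 \<subseteq> C \<union> C0"
      and C3: "C3 \<in> circuits M" "e \<in> C3" "C3 \<subseteq> C \<union> C0" "C3 - C0 \<subset> C - C0"
      and CC: "C \<subseteq> C2 \<union> C3" "nullity M (C2 \<union> C3) = 2" by blast
    have "card (C3 - C0) < card (C - C0)"
      using C3(4) less.prems M.finite_circuit by (intro psubset_card_mono) auto
    \<comment> \<open>\<open>C3\<close> passes through \<open>e\<close> and is closer to
      \<open>C0\<close>, so induction applies; \<open>C2\<close> avoids \<open>e\<close> and is
      itself one of the generators.\<close>
    then have "C3 \<in> cl N ?S"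
      using less.hyps C3 less.prems assms(1) by blast
    moreover have "C2 \<in> ?S" using C2 less.prems assms(1) by blast
    ultimately have "{C2, C3} \<subseteq> cl N ?S" using S by blast
    moreover have "C \<in> cl N {C2, C3}" using modular_cl[OF C2(1) C3(1) CC(2)] less.prems CC by blast
    ultimately show ?thesis using N.cl_minimal by blast
  qed
qed

text \<open>One new circuit \<open>C0\<close> through \<open>e\<close> spans all the others over the
  old ones, so adding \<open>e\<close> raises the \<open>N\<close>-rank by at most one.\<close>

lemma circs_insert_subset_cl:
  assumes "C0 \<in> circs (insert e X)" "e \<in> C0"
  shows "circs (insert e X) \<subseteq> cl N (insert C0 (circs X))"
proof
  fix C assume C: "C \<in> circs (insert e X)"
  let ?S = "insert C0 (circs X)"
  show "C \<in> cl N ?S"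
  proof (cases "e \<in> C")
    case True
    have "insert C0 (circs (X - {e})) \<subseteq> ?S" by auto
    from subsetD[OF N.cl_mono[OF this] circuit_exchange[OF assms C True]] show ?thesis .
  next
    case False
    moreover have "?S \<subseteq> cl N ?S" using assms(1) by (intro N.subset_cl) (auto simp: ground_N)
    ultimately show ?thesis using C by blast
  qed
qed

section \<open>The rank axioms for the lift\<close>

definition lift_rank :: "'a set \<Rightarrow> nat" where
  "lift_rank X = rank M X + rank N (circs X)"

lemma circs_rank_mono: "X \<subseteq> Y \<Longrightarrow> rank N (circs X) \<le> rank N (circs Y)"
  by (intro N.rank_mono circs_mono)

text \<open>The two summands never grow together: a circuit through \<open>e\<close> fixes the rank
  in \<open>M\<close>, and without one the set of circuits does not change.\<close>

lemma lift_rank_insert_le: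
  assumes "X \<subseteq> ground M" "e \<in> ground M"
  shows "lift_rank (insert e X) \<le> lift_rank X + 1"
proof (cases "\<exists>C0 \<in> circs (insert e X). e \<in> C0")
  case True
  then obtain C0 where C0: "C0 \<in> circs (insert e X)" "e \<in> C0" by blast
  have "rank M (insert e X) = rank M X" using C0 by (intro M.rank_insert_circuit) auto
  moreover have "rank N (circs (insert e X)) \<le> rank N (insert C0 (circs X))"
    using N.rank_Un_cl[OF circs_insert_subset_cl[OF C0]]
      N.rank_mono[of "circs (insert e X)" "insert C0 (circs X) \<union> circs (insert e X)"] by auto
  ultimately show ?thesis
    using N.rank_insert_le[of C0 "circs X"] by (simp add: lift_rank_def)
next
  case False
  then have "circs (insert e X) = circs X" by auto
  then show ?thesis using M.rank_insert_le[of e X] by (simp add: lift_rank_def)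
qed

lemma lift_rank_insert_eqD:
  assumes "X \<subseteq> ground M" "e \<in> ground M" "lift_rank (insert e X) = lift_rank X"
  shows "rank M (insert e X) = rank M X" "circs (insert e X) \<subseteq> cl N (circs X)"
proof -
  have le: "rank M X \<le> rank M (insert e X)" "rank N (circs X) \<le> rank N (circs (insert e X))"
    by (auto intro!: M.rank_mono circs_rank_mono)
  then show "rank M (insert e X) = rank M X" using assms(3) by (simp add: lift_rank_def)
  have "rank N (circs (insert e X)) = rank N (circs X)"
    using le assms(3) by (simp add: lift_rank_def)
  then show "circs (insert e X) \<subseteq> cl N (circs X)"
    by (intro N.rank_eq_imp_subset_cl circs_subset) auto
qed

text \<open>As \<open>X\<close> spans \<open>a\<close>, some circuit \<open>C0\<close> through
  \<open>a\<close> lies in \<open>insert a X\<close>. It also serves for the larger set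
  \<open>insert b X\<close>: all circuits there with \<open>a\<close> added are spanned by
  \<open>C0\<close> and those in \<open>insert b X\<close>, which the two equalities place in the
  closure of \<open>circs X\<close>.\<close>

lemma lift_rank_local:
  assumes "X \<subseteq> ground M" "a \<in> ground M" "b \<in> ground M"
    and "lift_rank (insert a X) = lift_rank X" "lift_rank (insert b X) = lift_rank X"
  shows "lift_rank (insert a (insert b X)) = lift_rank X"
proof (cases "a \<in> X")
  case True
  then show ?thesis using assms(5) by (metis insert_absorb insert_commute)
next
  case False
  note a = lift_rank_insert_eqD[OF assms(1,2,4)]
  note b = lift_rank_insert_eqD[OF assms(1,3,5)]
  obtain C0 where C0: "C0 \<in> circuits M" "a \<in> C0" "C0 \<subseteq> insert a X"
    using M.obtain_circuit[OF a(1) assms(2) False] by blast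
  have "circs (insert a (insert b X)) \<subseteq> cl N (insert C0 (circs (insert b X)))"
    using C0 by (intro circs_insert_subset_cl) auto
  also have "\<dots> \<subseteq> cl N (circs X)"
    using a(2) b(2) C0 by (intro N.cl_minimal) auto
  finally have "rank N (circs X \<union> circs (insert a (insert b X))) = rank N (circs X)"
    by (rule N.rank_Un_cl)
  moreover have "circs X \<union> circs (insert a (insert b X)) = circs (insert a (insert b X))" by auto
  moreover have "rank M (insert a (insert b X)) = rank M X"
    using M.rank_Un_absorb[of "{a, b}" X] a(1) b(1) by auto
  ultimately show ?thesis by (simp add: lift_rank_def)
qed

sublocale lift: rank_function "ground M" lift_rank
proof
  show "finite (ground M)" by (rule M.finite_ground)
  have *: "circs {} = {}" using M.circuit_not_empty by (metis (mono_tags, lifting) Collect_empty_eq subset_empty)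
  show "lift_rank {} = 0"
    unfolding lift_rank_def * using M.rank_le_card[of "{}"] N.rank_le_card[of "{}"] by simp
  show "lift_rank X \<le> lift_rank (insert e X)" for X e
    unfolding lift_rank_def by (intro add_mono M.rank_mono circs_rank_mono) auto
qed (use lift_rank_insert_le lift_rank_local in auto)

lemma is_rank_lift: "is_rank_lift (total_rank N) lift.rank_matroid M"
proof -
  have "is_lift lift.rank_matroid M"
  proof (rule quotient_is_lift)
    \<comment> \<open>The excess over the rank in \<open>M\<close> is the \<open>N\<close>-rank of
      \<open>circs\<close>, which is monotone.\<close>
    fix X Y assume XY: "X \<subseteq> Y" "Y \<subseteq> ground M"
    then show "rank M Y + rank lift.rank_matroid X \<le> rank lift.rank_matroid Y + rank M X"
      using circs_rank_mono[OF XY(1)] lift.rank_rank_matroid[of X] lift.rank_rank_matroid[of Y]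
      by (simp add: lift_rank_def)
  qed (use M.matroid_axioms lift.matroid_rank_matroid lift.ground_rank_matroid in auto)
  \<comment> \<open>On the whole ground set the excess is therefore the full rank of
    \<open>N\<close>.\<close>
  moreover have "circs (ground M) = ground N"
    using M.circuit_subset_ground by (auto simp: ground_N)
  ultimately show ?thesis
    unfolding is_rank_lift_def total_rank_def lift.ground_rank_matroid
    using lift.rank_rank_matroid[of "ground M"] by (simp add: lift_rank_def)
qed

end

theorem theorem1p2:
  fixes M :: "'a indep_system" and N :: "'a set indep_system" and r :: "'a set \<Rightarrow> int"
  assumes "matroid M"
    and "matroid N"
    and "ground N = circuits M"
    and "\<And>C1 C2. C1 \<in> circuits M \<Longrightarrow> C2 \<in> circuits M
      \<Longrightarrow> int (card (C1 \<union> C2)) - int (rank M (C1 \<union> C2)) = 2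
      \<Longrightarrow> \<forall>C \<in> circuits M. C \<subseteq> C1 \<union> C2 \<longrightarrow> C \<in> cl N {C1, C2}"
    and "\<And>X. X \<subseteq> ground M
      \<Longrightarrow> r X = int (rank M X) + int (rank N (circuits (restriction M X)))"
  shows "\<exists>L. is_rank_lift (total_rank N) L M \<and>
      (\<forall>X. X \<subseteq> ground M \<longrightarrow> r X = int (rank L X))"
proof -
  interpret M: matroid M by fact
  interpret N: matroid N by fact
  interpret circuit_matroid M N
  proof
    show "ground N = circuits M" by fact
    fix C1 C2 C
    assume C: "C1 \<in> circuits M" "C2 \<in> circuits M" "nullity M (C1 \<union> C2) = 2"
      "C \<in> circuits M" "C \<subseteq> C1 \<union> C2"
    then have "card (C1 \<union> C2) = rank M (C1 \<union> C2) + 2"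
      using M.card_eq_nullity[of "C1 \<union> C2"] M.finite_circuit by auto
    then show "C \<in> cl N {C1, C2}" using assms(4)[OF C(1,2)] C(4,5) by simp
  qed
  show ?thesis
  proof (intro exI conjI allI impI)
    show "is_rank_lift (total_rank N) lift.rank_matroid M" by (rule is_rank_lift)
    show "r X = int (rank lift.rank_matroid X)" if "X \<subseteq> ground M" for X
      using assms(5)[OF that] lift.rank_rank_matroid[OF that] M.circuits_restriction
      by (simp add: lift_rank_def)
  qed
qed

end
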